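(* Let $K\ge2$ and fix $k\in\{1,\dots,K\}$. Let $f(p)=\frac Kk\mathbf 1\{p\in(0,k/K]\}+\infty\,\mathbf 1\{p=0\}$ for $p\in[0,\infty)$, and define $F_{\mathrm{UR}}:[0,1]^{K+1}\to[0,1]$ by $$F_{\mathrm{UR}}(\mathbf p,u)=\inf\left\{\alpha\in(0,1):\ \frac1K\sum_{i=1}^K f\left(\frac{p_i}{\alpha}\right)\ge u\right\},\qquad\inf\varnothing=1 .$$ Then for all $\mathbf p\in[0,1]^K$ and $u\in(0,1]$, $$F_{\mathrm{UR}}(\mathbf p,u)=\min\left\{1,\ \frac Kk\,p_{(\lceil uk\rceil)}\,\mathbf 1\{p_{(1)}>0\}\right\},$$ and $F_{\mathrm{UR}}$ is a randomized p-merging function that strictly dominates the function $(\mathbf p,u)\mapsto F_{\mathrm R}(\mathbf p)=\frac Kk\,p_{(k)}$ on $[0,1]^{K+1}$.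
   Context: $\infty\cdot0=0$ in the definition of $f$ (so $f(0)=\infty$ and $f(p)<\infty$ for $p>0$). $p_{(j)}$ is the $j$-th smallest value among $p_1,\dots,p_K$. Fix an atomless probability space; $\mathcal U$ is the set of random variables uniform on $[0,1]$, $\mathcal U^K$ the set of random vectors (arbitrary joint distribution) with all $K$ components in $\mathcal U$, and $\mathcal U^K\otimes\mathcal U$ the set of pairs $(\mathbf P,U)\in\mathcal U^K\times\mathcal U$ with $U$ independent of $\mathbf P$. A randomized p-merging function is an increasing (non-decreasing in each component) Borel function $F:[0,1]^{K+1}\to[0,1]$ with $\mathbb P(F(\mathbf P,U)\le\alpha)\le\alpha$ for all $\alpha\in(0,1)$ and all $(\mathbf P,U)\in\mathcal U^K\otimes\mathcal U$. $F$ strictly dominates $G$ if $F\le G$ everywhere and $F<G$ at at least one point. *)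

theory Defs
  imports "HOL-Probability.Probability"
begin

text \<open>
  The index set \<open>{1,\<dots>,K}\<close> is a finite type \<open>'n\<close>, so that \<open>K = CARD('n)\<close>; points of
  \<open>[0,1]^(K+1)\<close> are pairs \<open>(p, u)\<close> with \<open>p :: real ^ 'n\<close> and \<open>u :: real\<close>. All functions on
  \<open>[0,1]^(K+1)\<close> are total functions of which only the values on \<open>unit_dom\<close> are constrained.
\<close>

definition unit_cube :: "(real ^ 'n) set" where
  "unit_cube = {p. \<forall>i. p $ i \<in> {0..1}}"

definition unit_dom :: "((real ^ 'n) \<times> real) set" where
  "unit_dom = unit_cube \<times> {0..1}"

text \<open>\<open>order_stat p j\<close> is \<open>p\<^sub>(\<^sub>j\<^sub>)\<close>, counted from \<open>j = 1\<close> and with multiplicities.\<close>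

definition order_stat :: "real ^ 'n \<Rightarrow> nat \<Rightarrow> real" where
  "order_stat p j = sorted_list_of_multiset (image_mset (\<lambda>i. p $ i) (mset_set UNIV)) ! (j - 1)"

definition atomless :: "'a measure \<Rightarrow> bool" where
  "atomless M \<longleftrightarrow> (\<forall>A\<in>sets M. 0 < emeasure M A \<longrightarrow>
     (\<exists>B\<in>sets M. B \<subseteq> A \<and> 0 < emeasure M B \<and> emeasure M B < emeasure M A))"

text \<open>
  Random variables uniform on \<open>[0,1]\<close> take their values in \<open>[0,1]\<close> everywhere (not just almost
  surely), so that they can be inserted into functions defined on \<open>[0,1]^(K+1)\<close>.
\<close>

definition uniform_rvs :: "'a measure \<Rightarrow> ('a \<Rightarrow> real) set" where
  "uniform_rvs M = {X \<in> borel_measurable M. (\<forall>\<omega>\<in>space M. X \<omega> \<in> {0..1}) \<and>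
     distr M borel X = uniform_measure lborel {0..1}}"

definition uniform_vecs :: "'a measure \<Rightarrow> ('a \<Rightarrow> real ^ 'n) set" where
  "uniform_vecs M = {P. \<forall>i. (\<lambda>\<omega>. P \<omega> $ i) \<in> uniform_rvs M}"

text \<open>
  Independence of \<open>P\<close> and \<open>U\<close> is stated via the generated \<open>\<sigma>\<close>-algebras, since \<open>indep_var\<close>
  requires both random variables to have the same value type.
\<close>

definition uniform_vecs_indep :: "'a measure \<Rightarrow> (('a \<Rightarrow> real ^ 'n) \<times> ('a \<Rightarrow> real)) set" where
  "uniform_vecs_indep M = {(P, U). P \<in> uniform_vecs M \<and> U \<in> uniform_rvs M \<and>
     prob_space.indep_set M {P -` A \<inter> space M | A. A \<in> sets borel}
                            {U -` B \<inter> space M | B. B \<in> sets borel}}"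

text \<open>The order on \<open>real ^ 'n \<times> real\<close> used by \<open>mono_on\<close> is the componentwise one.\<close>

definition randomized_p_merging :: "'a measure \<Rightarrow> ((real ^ 'n) \<times> real \<Rightarrow> real) \<Rightarrow> bool" where
  "randomized_p_merging M F \<longleftrightarrow>
     (\<forall>x\<in>unit_dom. F x \<in> {0..1}) \<and>
     mono_on unit_dom F \<and>
     F \<in> borel_measurable (restrict_space borel unit_dom) \<and>
     (\<forall>\<alpha>\<in>{0<..<1}. \<forall>(P, U)\<in>uniform_vecs_indep M.
        measure M {\<omega>\<in>space M. F (P \<omega>, U \<omega>) \<le> \<alpha>} \<le> \<alpha>)"

definition strictly_dominates ::
    "((real ^ 'n) \<times> real \<Rightarrow> real) \<Rightarrow> ((real ^ 'n) \<times> real \<Rightarrow> real) \<Rightarrow> bool" where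
  "strictly_dominates F G \<longleftrightarrow> (\<forall>x\<in>unit_dom. F x \<le> G x) \<and> (\<exists>x\<in>unit_dom. F x < G x)"

text \<open>Multiplication in \<^typ>\<open>ennreal\<close> satisfies \<open>\<infinity> * 0 = 0\<close>.\<close>

definition calib :: "nat \<Rightarrow> nat \<Rightarrow> real \<Rightarrow> ennreal" where
  "calib K k p = ennreal (real K / real k) * indicator {0<..real k / real K} p
                 + \<infinity> * indicator {0} p"

definition F_UR :: "nat \<Rightarrow> (real ^ 'n) \<times> real \<Rightarrow> real" where
  "F_UR k = (\<lambda>(p, u).
     let K = CARD('n);
         A = {\<alpha>\<in>{0<..<1}. (\<Sum>i\<in>UNIV. calib K k (p $ i / \<alpha>)) / of_nat K \<ge> ennreal u}
     in if A = {} then 1 else Inf A)"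

definition F_R :: "nat \<Rightarrow> real ^ 'n \<Rightarrow> real" where
  "F_R k p = real CARD('n) / real k * order_stat p k"

end

theory Submission
  imports Defs
begin

text \<open>
  For \<open>\<alpha> > 0\<close> the inequality defining \<open>F\<^sub>U\<^sub>R(p,u)\<close> says that some \<open>p\<^sub>i\<close> vanishes or that at
  least \<open>u k\<close> of the \<open>p\<^sub>i\<close> are at most \<open>\<alpha> k / K\<close>. The latter means
  \<open>p\<^sub>(\<^sub>j\<^sub>) \<le> \<alpha> k / K\<close> with \<open>j = \<lceil>u k\<rceil>\<close>, which gives the closed form. For the
  merging property, almost surely no \<open>P\<^sub>i\<close> vanishes, and if \<open>N\<close> of the \<open>P\<^sub>i\<close> are at
  most \<open>c = \<beta> k / K\<close>, then by independence of \<open>U\<close> the probability of \<open>U \<le> N / k\<close> is at most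
  \<open>E N / k = K c / k = \<beta>\<close>. Letting \<open>\<beta>\<close> decrease to \<open>\<alpha>\<close> avoids any discussion of whether the
  infimum is attained.
\<close>

section \<open>Order statistics as counting statements\<close>

lemma sorted_nth_le_iff:
  fixes xs :: "'a :: linorder list"
  assumes "sorted xs" and "j < length xs"
  shows "xs ! j \<le> x \<longleftrightarrow> j < length (filter (\<lambda>y. y \<le> x) xs)"
  using assms
proof (induction xs arbitrary: j)
  case Nil
  then show ?case by simp
next
  case (Cons a xs)
  show ?case
  proof (cases "a \<le> x")
    case True
    then show ?thesis using Cons by (cases j) auto
  next
    \<comment> \<open>The head is the least entry, so once it exceeds \<open>x\<close> no entry is
      counted and both sides are false.\<close>
    case False
    then have *: "\<not> y \<le> x" if "y \<in> set (a # xs)" for y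
      using Cons.prems(1) that by auto
    have "(a # xs) ! j \<in> set (a # xs)"
      using Cons.prems(2) nth_mem by blast
    moreover have "filter (\<lambda>y. y \<le> x) (a # xs) = []"
      using * by (simp only: filter_empty_conv) blast
    ultimately show ?thesis using * by auto
  qed
qed

text \<open>The entries at most \<open>x\<close> form an initial segment of the sorted list, whose
  length is the cardinality on the right, multiplicities included. All later facts about
  \<open>order_stat\<close> are derived from this count.\<close>

lemma order_stat_le_iff:
  fixes p :: "real ^ 'n::finite"
  assumes "1 \<le> j" and "j \<le> CARD('n)"
  shows "order_stat p j \<le> x \<longleftrightarrow> j \<le> card {i. p $ i \<le> x}"
proof -
  define m where "m = image_mset (\<lambda>i. p $ i) (mset_set (UNIV :: 'n set))"
  define xs where "xs = sorted_list_of_multiset m"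
  have mset: "mset xs = m" and sorted: "sorted xs"
    by (simp_all add: xs_def)
  have len: "length xs = CARD('n)"
    using arg_cong[OF mset, of size] by (simp add: m_def)
  have "length (filter (\<lambda>y. y \<le> x) xs) = size (filter_mset (\<lambda>y. y \<le> x) m)"
    by (metis mset mset_filter size_mset)
  also have "\<dots> = card {i. p $ i \<le> x}"
    by (simp add: m_def filter_mset_image_mset)
  finally have "length (filter (\<lambda>y. y \<le> x) xs) = card {i. p $ i \<le> x}" .
  \<comment> \<open>Lists are indexed from 0; since \<open>1 \<le> j\<close>, the bound
    \<open>j - 1 < n\<close> is the same as \<open>j \<le> n\<close>.\<close>
  then show ?thesis
    using sorted_nth_le_iff[OF sorted, of "j - 1" x] assms len
    by (auto simp: order_stat_def xs_def m_def)
qed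

text \<open>At the threshold \<open>order_stat p j\<close> at least \<open>j\<close>, hence at least
  \<open>i\<close>, entries are counted.\<close>

lemma order_stat_mono:
  fixes p :: "real ^ 'n::finite"
  assumes "1 \<le> i" and "i \<le> j" and "j \<le> CARD('n)"
  shows "order_stat p i \<le> order_stat p j"
  using order_stat_le_iff[of i p "order_stat p j"] order_stat_le_iff[of j p "order_stat p j"] assms
  by auto

lemma order_stat_1_pos_iff:
  fixes p :: "real ^ 'n::finite"
  shows "0 < order_stat p 1 \<longleftrightarrow> (\<forall>i. 0 < p $ i)"
proof -
  have "order_stat p 1 \<le> 0 \<longleftrightarrow> 1 \<le> card {i. p $ i \<le> 0}"
    by (rule order_stat_le_iff) (simp_all add: Suc_leI)
  also have "\<dots> \<longleftrightarrow> (\<exists>i. p $ i \<le> 0)"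
    by (auto simp: Suc_le_eq card_gt_0_iff)
  finally show ?thesis by (auto simp: not_le[symmetric])
qed

section \<open>The level condition under the infimum\<close>

definition passes :: "nat \<Rightarrow> real ^ 'n \<Rightarrow> real \<Rightarrow> real \<Rightarrow> bool" where
  "passes k p u \<alpha> \<longleftrightarrow>
     (\<exists>i. p $ i = 0) \<or> u * real k \<le> real (card {i. p $ i \<le> \<alpha> * real k / real CARD('n)})"

text \<open>A zero entry makes the average infinite. Otherwise each entry at most
  \<open>\<alpha> * k / K\<close> adds \<open>1 / k\<close> to the average and every other entry
  adds nothing. This trades extended reals for a count.\<close>

lemma calib_sum_ge_iff:
  fixes p :: "real ^ 'n::finite"
  assumes p: "p \<in> unit_cube" and \<alpha>: "0 < \<alpha>" and k: "1 \<le> k"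
  shows "ennreal u \<le> (\<Sum>i\<in>UNIV. calib CARD('n) k (p $ i / \<alpha>)) / of_nat CARD('n) \<longleftrightarrow>
    passes k p u \<alpha>"
proof (cases "\<exists>i. p $ i = 0")
  case True
  then obtain i where i: "p $ i = 0" by blast
  have "calib CARD('n) k (p $ i / \<alpha>) = \<infinity>"
    using i by (simp add: calib_def)
  then have "(\<Sum>i\<in>UNIV. calib CARD('n) k (p $ i / \<alpha>)) = \<infinity>"
    by (subst sum.remove[of UNIV i]) auto
  then have "(\<Sum>i\<in>UNIV. calib CARD('n) k (p $ i / \<alpha>)) / of_nat CARD('n) = \<top>"
    by (simp only:) (simp add: ennreal_top_divide)
  then show ?thesis
    using True by (simp only: passes_def top_greatest simp_thms)
next
  case False
  define K where "K = CARD('n)"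
  have K: "0 < K" by (simp add: K_def)
  have pos: "0 < p $ i" for i
    using p False by (auto simp: unit_cube_def less_le)
  define S where "S = {i. p $ i \<le> \<alpha> * real k / real K}"
  have "calib K k (p $ i / \<alpha>) = ennreal (real K / real k * indicator S i)" for i
    using pos[of i] \<alpha> K k
    by (auto simp: calib_def S_def indicator_def field_simps split: if_splits)
  then have "(\<Sum>i\<in>UNIV. calib K k (p $ i / \<alpha>)) = ennreal (\<Sum>i\<in>UNIV. real K / real k * indicator S i)"
    by (simp add: sum_ennreal)
  also have "(\<Sum>i\<in>UNIV. real K / real k * indicator S i) = real K / real k * real (card S)"
    by (simp only: sum_distrib_left[symmetric]) (simp add: indicator_def sum.If_cases)
  finally have "(\<Sum>i\<in>UNIV. calib K k (p $ i / \<alpha>)) / of_nat K = ennreal (real (card S) / real k)"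
    using K k by (simp add: ennreal_of_nat_eq_real_of_nat divide_ennreal)
  moreover have "u \<le> real (card S) / real k \<longleftrightarrow> passes k p u \<alpha>"
    using False k by (auto simp: passes_def S_def K_def field_simps)
  \<comment> \<open>\<open>ennreal\<close> sends a negative \<open>u\<close> to 0; as the average is
    nonnegative, comparing it with \<open>u\<close> or with the truncation gives the same
    answer.\<close>
  ultimately show ?thesis
    by (simp add: K_def ennreal_le_iff)
qed

lemma F_UR_eq_passes:
  fixes p :: "real ^ 'n::finite"
  assumes "p \<in> unit_cube" and "1 \<le> k"
  shows "F_UR k (p, u) =
    (if {\<alpha>\<in>{0<..<1}. passes k p u \<alpha>} = {} then 1 else Inf {\<alpha>\<in>{0<..<1}. passes k p u \<alpha>})"
proof -
  have "{\<alpha>\<in>{0<..<1}. (\<Sum>i\<in>UNIV. calib CARD('n) k (p $ i / \<alpha>)) / of_nat CARD('n) \<ge> ennreal u}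
      = {\<alpha>\<in>{0<..<1}. passes k p u \<alpha>}"
    using calib_sum_ge_iff[OF assms(1) _ assms(2)] by auto
  then show ?thesis
    by (simp only: F_UR_def Let_def prod.case)
qed

text \<open>Smaller entries and a larger level enlarge the count, and a smaller \<open>u\<close>
  lowers the bar. A zero entry of \<open>q\<close> remains zero in \<open>p\<close> because entries
  of \<open>p\<close> are nonnegative.\<close>

lemma passes_mono:
  fixes p q :: "real ^ 'n::finite"
  assumes "passes k q v \<alpha>" and "p \<in> unit_cube" and "\<And>i. p $ i \<le> q $ i" and "u \<le> v"
    and "\<alpha> \<le> \<beta>"
  shows "passes k p u \<beta>"
proof (cases "\<exists>i. q $ i = 0")
  case True
  then obtain i where "q $ i = 0" by blast
  then have "p $ i = 0"
    using assms(2) assms(3)[of i] by (auto simp: unit_cube_def intro: antisym)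
  then show ?thesis by (auto simp: passes_def)
next
  case False
  have *: "\<alpha> * real k / real CARD('n) \<le> \<beta> * real k / real CARD('n)"
    using assms(5) by (intro divide_right_mono mult_right_mono) auto
  have "{i. q $ i \<le> \<alpha> * real k / real CARD('n)} \<subseteq> {i. p $ i \<le> \<beta> * real k / real CARD('n)}"
    using * assms(3) by (auto intro: order_trans)
  then have "card {i. q $ i \<le> \<alpha> * real k / real CARD('n)}
      \<le> card {i. p $ i \<le> \<beta> * real k / real CARD('n)}"
    by (intro card_mono) auto
  moreover have "u * real k \<le> v * real k"
    using assms(4) by (intro mult_right_mono) auto
  ultimately show ?thesis
    using assms(1) False by (auto simp: passes_def)
qed

text \<open>An infimum lies strictly below \<open>a\<close> exactly when some member does, whether
  or not it is attained. The bound \<open>a \<le> 1\<close> fits the default value 1 of the empty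
  set: there both sides are false.\<close>

lemma F_UR_less_iff:
  fixes p :: "real ^ 'n::finite"
  assumes "p \<in> unit_cube" and "1 \<le> k" and "a \<le> 1"
  shows "F_UR k (p, u) < a \<longleftrightarrow> (\<exists>\<alpha>\<in>{0<..<a}. passes k p u \<alpha>)"
proof -
  let ?A = "{\<alpha>\<in>{0<..<1}. passes k p u \<alpha>}"
  have bdd: "bdd_below ?A"
    by (rule bdd_belowI[of _ 0]) auto
  have "F_UR k (p, u) < a \<longleftrightarrow> (\<exists>\<alpha>\<in>?A. \<alpha> < a)"
  proof (cases "?A = {}")
    case True
    then have "F_UR k (p, u) = 1"
      by (simp only: F_UR_eq_passes[OF assms(1,2)]) simp
    then show ?thesis
      using True assms(3) by auto
  next
    case False
    then have "F_UR k (p, u) = Inf ?A"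
      by (simp only: F_UR_eq_passes[OF assms(1,2)] if_False)
    then show ?thesis
      using cInf_less_iff[OF False bdd] by simp
  qed
  also have "\<dots> \<longleftrightarrow> (\<exists>\<alpha>\<in>{0<..<a}. passes k p u \<alpha>)"
    using assms(3) by auto
  finally show ?thesis .
qed

lemma F_UR_range:
  fixes p :: "real ^ 'n::finite"
  assumes "p \<in> unit_cube" and "1 \<le> k"
  shows "F_UR k (p, u) \<in> {0..1}"
proof -
  let ?A = "{\<alpha>\<in>{0<..<1}. passes k p u \<alpha>}"
  have "0 \<le> F_UR k (p, u)"
    using F_UR_eq_passes[OF assms, of u] by (auto intro!: cInf_greatest split: if_splits)
  moreover have "F_UR k (p, u) \<le> 1"
  proof (rule ccontr)
    assume "\<not> F_UR k (p, u) \<le> 1"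
    then obtain \<alpha> where "\<alpha> \<in> ?A" and "1 < Inf ?A"
      using F_UR_eq_passes[OF assms, of u] by (auto split: if_splits)
    moreover have "bdd_below ?A"
      by (rule bdd_belowI[of _ 0]) auto
    ultimately show False
      using cInf_lower[of \<alpha> ?A] by auto
  qed
  ultimately show ?thesis by simp
qed

text \<open>At \<open>u = 0\<close> the closed form would ask for the order statistic of index 0, so
  this boundary is treated apart: every level passes. It enters both the domination and its
  strictness.\<close>

lemma F_UR_u_zero:
  fixes p :: "real ^ 'n::finite"
  assumes "p \<in> unit_cube" and "1 \<le> k"
  shows "F_UR k (p, 0) = 0"
proof -
  have "{\<alpha>\<in>{0<..<1}. passes k p 0 \<alpha>} = {0<..<1}"
    by (auto simp: passes_def)
  then show ?thesis
    by (simp add: F_UR_eq_passes[OF assms])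
qed

section \<open>Closed form\<close>

lemma F_UR_closed_form:
  fixes p :: "real ^ 'n::finite"
  assumes p: "p \<in> unit_cube" and k: "1 \<le> k" "k \<le> CARD('n)" and u: "0 < u" "u \<le> 1"
  shows "F_UR k (p, u) =
    min 1 (real CARD('n) / real k * order_stat p (nat \<lceil>u * real k\<rceil>)
      * indicator {0<..} (order_stat p 1))"
proof (cases "\<exists>i. p $ i = 0")
  case True
  then have "\<not> 0 < order_stat p 1"
    by (metis less_irrefl order_stat_1_pos_iff)
  moreover have "F_UR k (p, u) = 0"
  proof -
    have "{\<alpha>\<in>{0<..<1}. passes k p u \<alpha>} = {0<..<1}"
      using True by (auto simp: passes_def)
    then show ?thesis
      by (simp add: F_UR_eq_passes[OF p k(1)])
  qed
  ultimately show ?thesis by simp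
next
  case False
  then have "\<forall>i. 0 < p $ i"
    using p by (auto simp: unit_cube_def less_le)
  then have pos1: "0 < order_stat p 1"
    using order_stat_1_pos_iff[of p] by blast
  define j where "j = nat \<lceil>u * real k\<rceil>"
  define c where "c = real CARD('n) / real k * order_stat p j"
  have "0 < u * real k"
    using u k by simp
  then have j1: "1 \<le> j"
    unfolding j_def by linarith
  have "u * real k \<le> real k"
    using u by (simp add: mult_left_le_one_le)
  then have jk: "j \<le> k"
    by (simp add: j_def ceiling_le_iff)
  have "0 < order_stat p j"
    using pos1 order_stat_mono[of 1 j p] j1 jk k by linarith
  then have c: "0 < c"
    using k by (simp add: c_def)
  have passes_iff: "passes k p u \<alpha> \<longleftrightarrow> c \<le> \<alpha>" for \<alpha>
  proof -
    let ?n = "card {i. p $ i \<le> \<alpha> * real k / real CARD('n)}"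
    have "passes k p u \<alpha> \<longleftrightarrow> u * real k \<le> real ?n"
      using False by (simp add: passes_def)
    \<comment> \<open>The count is an integer, so \<open>u * k\<close> may be rounded up.\<close>
    also have "\<dots> \<longleftrightarrow> j \<le> ?n"
      by (simp add: j_def ceiling_le_iff)
    also have "\<dots> \<longleftrightarrow> order_stat p j \<le> \<alpha> * real k / real CARD('n)"
      using order_stat_le_iff[OF j1, of p] jk k by simp
    also have "\<dots> \<longleftrightarrow> c \<le> \<alpha>"
      using k by (simp add: c_def field_simps)
    finally show ?thesis .
  qed
  \<comment> \<open>As \<open>c > 0\<close>, the condition \<open>c \<le> \<alpha>\<close> already
    forces \<open>0 < \<alpha>\<close>.\<close>
  have A: "{\<alpha>\<in>{0<..<1}. passes k p u \<alpha>} = {c..<1}"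
    unfolding passes_iff using c by fastforce
  \<comment> \<open>For \<open>c \<ge> 1\<close> the interval is empty and the default 1 applies;
    otherwise its infimum is \<open>c\<close>.\<close>
  have "F_UR k (p, u) = min 1 c"
    unfolding F_UR_eq_passes[OF p k(1)] A by simp
  then show ?thesis
    using pos1 by (simp add: c_def j_def)
qed

section \<open>Monotonicity and measurability\<close>

lemma mono_on_F_UR:
  assumes "1 \<le> k"
  shows "mono_on unit_dom (F_UR k :: (real ^ 'n::finite) \<times> real \<Rightarrow> real)"
proof (rule mono_onI)
  fix x y :: "(real ^ 'n) \<times> real"
  assume x: "x \<in> unit_dom" and y: "y \<in> unit_dom" and "x \<le> y"
  obtain p u q v where xy: "x = (p, u)" "y = (q, v)"
    by (metis surj_pair)
  have pq: "p \<in> unit_cube" "q \<in> unit_cube"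
    using x y by (auto simp: xy unit_dom_def)
  have le: "p $ i \<le> q $ i" "u \<le> v" for i
    using \<open>x \<le> y\<close> by (auto simp: xy less_eq_vec_def)
  show "F_UR k x \<le> F_UR k y"
  proof (rule ccontr)
    assume "\<not> F_UR k x \<le> F_UR k y"
    then have "F_UR k (q, v) < F_UR k (p, u)"
      by (simp add: xy)
    moreover have "F_UR k (p, u) \<le> 1"
      using F_UR_range[OF pq(1) assms] by simp
    ultimately obtain \<alpha> where \<alpha>: "\<alpha> \<in> {0<..<F_UR k (p, u)}" "passes k q v \<alpha>"
      using F_UR_less_iff[OF pq(2) assms] by blast
    \<comment> \<open>The strict criterion needs a passing level below its bound, so
      \<open>\<beta>\<close> is inserted between \<open>\<alpha>\<close> and the value at
      \<open>(p, u)\<close>.\<close>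
    then obtain \<beta> where \<beta>: "\<alpha> < \<beta>" "\<beta> < F_UR k (p, u)"
      using dense[of \<alpha> "F_UR k (p, u)"] by auto
    have "passes k p u \<alpha>"
      using passes_mono[OF \<alpha>(2) pq(1) le order_refl] .
    then have "F_UR k (p, u) < \<beta>"
      using F_UR_less_iff[OF pq(1) assms, of \<beta> u] \<alpha>(1) \<beta> \<open>F_UR k (p, u) \<le> 1\<close> by auto
    then show False using \<beta> by simp
  qed
qed

lemma card_eq_sum_indicator:
  fixes p :: "real ^ 'n::finite"
  shows "real (card {i. p $ i \<le> c}) = (\<Sum>i\<in>UNIV. indicator {..c} (p $ i))"
  by (simp add: indicator_def sum.If_cases)

lemma borel_measurable_card_le:
  "(\<lambda>p :: real ^ 'n::finite. real (card {i. p $ i \<le> c})) \<in> borel_measurable borel"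
  unfolding card_eq_sum_indicator by measurable

lemma sets_passes:
  "{x :: (real ^ 'n::finite) \<times> real. passes k (fst x) (snd x) \<alpha>} \<in> sets borel"
proof -
  note [measurable] = borel_measurable_card_le
  have [measurable]: "(\<lambda>x :: (real ^ 'n) \<times> real. fst x) \<in> borel_measurable borel"
    "(\<lambda>x :: (real ^ 'n) \<times> real. snd x) \<in> borel_measurable borel"
    by (simp_all add: borel_measurable_continuous_onI continuous_on_fst continuous_on_snd)
  have [measurable]: "(\<lambda>x :: (real ^ 'n) \<times> real.
      real (card {i. fst x $ i \<le> \<alpha> * real k / real CARD('n)})) \<in> borel_measurable borel"
    by (rule measurable_compose[OF _ borel_measurable_card_le]) measurable
  show ?thesis
    unfolding passes_def by measurable
qed

text \<open>A strict sublevel set is a union over all levels below \<open>a\<close>. Passing is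
  preserved when the level rises, so rational levels suffice and the union becomes
  countable.\<close>

lemma borel_measurable_F_UR:
  assumes k: "1 \<le> k"
  shows "(F_UR k :: (real ^ 'n::finite) \<times> real \<Rightarrow> real)
    \<in> borel_measurable (restrict_space borel unit_dom)"
proof (rule borel_measurableI_less)
  fix a :: real
  let ?M = "restrict_space borel unit_dom :: ((real ^ 'n) \<times> real) measure"
  have space: "space ?M = unit_dom"
    by (simp add: space_restrict_space)
  show "{x \<in> space ?M. F_UR k x < a} \<in> sets ?M"
  proof (cases "a \<le> 1")
    case True
    have "{x \<in> space ?M. F_UR k x < a} =
        unit_dom \<inter> (\<Union>r\<in>\<rat> \<inter> {0<..<a}. {x. passes k (fst x) (snd x) r})" (is "?L = ?R")
    proof (rule set_eqI)
      fix x :: "(real ^ 'n) \<times> real"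
      obtain p u where x: "x = (p, u)" by (metis surj_pair)
      show "x \<in> ?L \<longleftrightarrow> x \<in> ?R"
      proof (cases "x \<in> unit_dom")
        case dom: True
        then have p: "p \<in> unit_cube" by (auto simp: x unit_dom_def)
        have "\<exists>r\<in>\<rat> \<inter> {0<..<a}. passes k p u r" if "\<alpha> \<in> {0<..<a}" "passes k p u \<alpha>" for \<alpha>
        proof -
          obtain r where "r \<in> \<rat>" "\<alpha> < r" "r < a"
            using Rats_dense_in_real[of \<alpha> a] \<open>\<alpha> \<in> {0<..<a}\<close> by auto
          moreover from this have "passes k p u r"
            using passes_mono[OF \<open>passes k p u \<alpha>\<close> p] by simp
          ultimately show ?thesis using \<open>\<alpha> \<in> {0<..<a}\<close> by auto
        qed
        then show ?thesis
          using dom F_UR_less_iff[OF p k True, of u] by (auto simp: x space)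
      qed (simp add: space)
    qed
    moreover have "(\<Union>r\<in>\<rat> \<inter> {0<..<a}. {x :: (real ^ 'n) \<times> real. passes k (fst x) (snd x) r}) \<in> sets borel"
      by (intro sets.countable_UN'' sets_passes) (simp add: countable_rat countable_Int1)
    ultimately show ?thesis
      by (auto simp: sets_restrict_space)
  next
    case False
    have "F_UR k x < a" if "x \<in> unit_dom" for x :: "(real ^ 'n) \<times> real"
      using F_UR_range[OF _ k, of "fst x" "snd x"] that False by (auto simp: unit_dom_def)
    then have "{x \<in> space ?M. F_UR k x < a} = space ?M"
      by (auto simp: space)
    then show ?thesis by simp
  qed
qed

section \<open>Probability bound\<close>

lemma measure_uniform_rv_le:
  assumes "prob_space M" and X: "X \<in> uniform_rvs M" and c: "0 \<le> c"
  shows "measure M {\<omega>\<in>space M. X \<omega> \<le> c} \<le> c"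
proof -
  interpret prob_space M by fact
  have meas: "X \<in> borel_measurable M" and distr: "distr M borel X = uniform_measure lborel {0..1}"
    using X by (auto simp: uniform_rvs_def)
  have "emeasure M {\<omega>\<in>space M. X \<omega> \<le> c} = emeasure (distr M borel X) {..c}"
    using meas by (subst emeasure_distr) (auto intro!: arg_cong[where f = "emeasure M"])
  also have "\<dots> = emeasure lborel ({0..1} \<inter> {..c})"
    by (simp add: distr divide_ennreal_def)
  \<comment> \<open>Only an inequality, since \<open>c\<close> may exceed 1; this happens below for
    the threshold \<open>j / k\<close> with \<open>j > k\<close>.\<close>
  also have "\<dots> \<le> emeasure lborel {0..c}"
    by (intro emeasure_mono) auto
  also have "\<dots> = ennreal c"
    using c by simp
  finally show ?thesis
    using c by (simp add: emeasure_eq_measure)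
qed

text \<open>Splitting by the finitely many values \<open>j\<close> of the count replaces
  conditioning on \<open>P\<close>: given the count \<open>j\<close>, the remaining event
  \<open>U \<le> j / k\<close> is independent of it. The expected count is linear in the marginals,
  so arbitrary dependence among the components is allowed.\<close>

lemma measure_passes_le:
  fixes P :: "'a \<Rightarrow> real ^ 'n::finite"
  assumes "prob_space M" and PU: "(P, U) \<in> uniform_vecs_indep M"
    and k: "1 \<le> k" and \<beta>: "0 \<le> \<beta>"
  shows "{\<omega>\<in>space M. passes k (P \<omega>) (U \<omega>) \<beta>} \<in> sets M"
    and "measure M {\<omega>\<in>space M. passes k (P \<omega>) (U \<omega>) \<beta>} \<le> \<beta>"
proof -
  interpret prob_space M by fact
  have P: "(\<lambda>\<omega>. P \<omega> $ i) \<in> uniform_rvs M" for i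
    using PU by (auto simp: uniform_vecs_indep_def uniform_vecs_def)
  have U: "U \<in> uniform_rvs M"
    using PU by (auto simp: uniform_vecs_indep_def)
  have indep: "indep_set {P -` A \<inter> space M | A. A \<in> sets borel} {U -` B \<inter> space M | B. B \<in> sets borel}"
    using PU by (auto simp: uniform_vecs_indep_def)
  have [measurable]: "(\<lambda>\<omega>. P \<omega> $ i) \<in> borel_measurable M" for i
    using P by (auto simp: uniform_rvs_def)
  have [measurable]: "U \<in> borel_measurable M"
    using U by (auto simp: uniform_rvs_def)
  define K where "K = CARD('n)"
  define c where "c = \<beta> * real k / real K"
  have c: "0 \<le> c"
    using \<beta> by (simp add: c_def)
  define N where "N p = card {i. p $ i \<le> c}" for p :: "real ^ 'n"
  have N_le: "N p \<le> K" for p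
    unfolding N_def K_def by (rule card_mono) auto
  have N_sum: "real (N p) = (\<Sum>i\<in>UNIV. indicator {..c} (p $ i))" for p
    unfolding N_def by (rule card_eq_sum_indicator)
  \<comment> \<open>Independence is formulated for preimages under \<open>P\<close>, so
    \<open>E j\<close> must come from a Borel set of vectors.\<close>
  have N_borel: "{p. N p = j} \<in> sets borel" for j
  proof -
    have "{p \<in> space borel. real (N p) = real j} \<in> sets borel"
      unfolding N_def by (rule borel_measurable_eq[OF borel_measurable_card_le]) simp
    then show ?thesis by simp
  qed
  have [measurable]: "(\<lambda>\<omega>. real (N (P \<omega>))) \<in> borel_measurable M"
    unfolding N_sum by measurable
  \<comment> \<open>Using \<open>\<le> 0\<close> instead of \<open>= 0\<close> lets the bound for
    uniform variables apply with \<open>c = 0\<close>, making \<open>Z\<close> a null set.\<close>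
  define Z where "Z = (\<Union>i. {\<omega>\<in>space M. P \<omega> $ i \<le> 0})"
  define E where "E j = {\<omega>\<in>space M. N (P \<omega>) = j}" for j
  define V where "V j = {\<omega>\<in>space M. U \<omega> \<le> real j / real k}" for j
  have E [measurable]: "E j \<in> sets M" for j
  proof -
    have "E j = {\<omega>\<in>space M. real (N (P \<omega>)) = real j}"
      by (simp add: E_def)
    also have "\<dots> \<in> sets M" by measurable
    finally show ?thesis .
  qed
  have V [measurable]: "V j \<in> sets M" for j
    unfolding V_def by measurable
  have Z [measurable]: "Z \<in> sets M"
    unfolding Z_def by measurable
  have EV: "prob (E j \<inter> V j) \<le> prob (E j) * (real j / real k)" for j
  proof -
    have "E j \<in> {P -` A \<inter> space M | A. A \<in> sets borel}"
      using N_borel[of j] by (auto simp: E_def intro!: exI[of _ "{p. N p = j}"])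
    moreover have "V j \<in> {U -` B \<inter> space M | B. B \<in> sets borel}"
      by (auto simp: V_def intro!: exI[of _ "{..real j / real k}"])
    ultimately have "prob (E j \<inter> V j) = prob (E j) * prob (V j)"
      using indep by (rule indep_setD[rotated])
    also have "\<dots> \<le> prob (E j) * (real j / real k)"
      unfolding V_def by (intro mult_left_mono measure_uniform_rv_le[OF assms(1) U]) auto
    finally show ?thesis .
  qed
  have Z0: "prob Z = 0"
  proof -
    have "prob Z \<le> (\<Sum>i\<in>UNIV. prob {\<omega>\<in>space M. P \<omega> $ i \<le> 0})"
      unfolding Z_def by (rule finite_measure_subadditive_finite) auto
    also have "\<dots> \<le> (\<Sum>i\<in>(UNIV :: 'n set). 0)"
      by (intro sum_mono measure_uniform_rv_le[OF assms(1) P]) simp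
    finally show ?thesis
      by (simp add: measure_le_0_iff)
  qed
  have integrable_E: "integrable M (indicat_real (E j))" for j
    by (rule integrable_real_indicator) (auto simp: emeasure_eq_measure)
  \<comment> \<open>The events \<open>E j\<close> with \<open>j \<le> K\<close> partition the space,
    and the count equals \<open>j\<close> on \<open>E j\<close>.\<close>
  have expect: "(\<Sum>j\<le>K. prob (E j) * real j) = expectation (\<lambda>\<omega>. real (N (P \<omega>)))"
  proof -
    have "expectation (\<lambda>\<omega>. real (N (P \<omega>))) = expectation (\<lambda>\<omega>. \<Sum>j\<le>K. indicator (E j) \<omega> * real j)"
    proof (rule Bochner_Integration.integral_cong)
      fix \<omega> assume "\<omega> \<in> space M"
      then have "(\<Sum>j\<le>K. indicator (E j) \<omega> * real j) = (\<Sum>j\<le>K. if j = N (P \<omega>) then real j else 0)"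
        by (intro sum.cong) (auto simp: E_def indicator_def)
      then show "real (N (P \<omega>)) = (\<Sum>j\<le>K. indicator (E j) \<omega> * real j)"
        using N_le by simp
    qed simp
    also have "\<dots> = (\<Sum>j\<le>K. prob (E j) * real j)"
      using integrable_E by (subst Bochner_Integration.integral_sum) auto
    finally show ?thesis by simp
  qed
  \<comment> \<open>The same expectation, now computed component by component.\<close>
  have "expectation (\<lambda>\<omega>. real (N (P \<omega>)))
      = expectation (\<lambda>\<omega>. \<Sum>i\<in>UNIV. indicator {\<omega>\<in>space M. P \<omega> $ i \<le> c} \<omega>)"
    unfolding N_sum by (intro Bochner_Integration.integral_cong sum.cong) (auto simp: indicator_def)
  also have "\<dots> = (\<Sum>i\<in>UNIV. prob {\<omega>\<in>space M. P \<omega> $ i \<le> c})"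
    by (subst Bochner_Integration.integral_sum)
      (auto intro!: integrable_real_indicator simp: emeasure_eq_measure)
  also have "\<dots> \<le> (\<Sum>i\<in>(UNIV :: 'n set). c)"
    by (intro sum_mono measure_uniform_rv_le[OF assms(1) P c])
  finally have expect_le: "expectation (\<lambda>\<omega>. real (N (P \<omega>))) \<le> real K * c"
    by (simp add: K_def)
  have eq: "{\<omega>\<in>space M. passes k (P \<omega>) (U \<omega>) \<beta>}
      = (\<Union>i. {\<omega>\<in>space M. P \<omega> $ i = 0}) \<union> {\<omega>\<in>space M. U \<omega> * real k \<le> real (N (P \<omega>))}"
    by (auto simp: passes_def N_def c_def K_def)
  show "{\<omega>\<in>space M. passes k (P \<omega>) (U \<omega>) \<beta>} \<in> sets M"
    unfolding eq by measurable
  \<comment> \<open>Outside \<open>Z\<close>, the index to choose is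
    \<open>j = N (P \<omega>)\<close>.\<close>
  have "{\<omega>\<in>space M. passes k (P \<omega>) (U \<omega>) \<beta>} \<subseteq> Z \<union> (\<Union>j\<le>K. E j \<inter> V j)"
    using N_le k by (auto simp: eq Z_def E_def V_def field_simps)
  then have "prob {\<omega>\<in>space M. passes k (P \<omega>) (U \<omega>) \<beta>} \<le> prob (Z \<union> (\<Union>j\<le>K. E j \<inter> V j))"
    by (rule finite_measure_mono) auto
  also have "\<dots> \<le> prob Z + prob (\<Union>j\<le>K. E j \<inter> V j)"
    by (rule measure_Un_le) auto
  also have "prob (\<Union>j\<le>K. E j \<inter> V j) \<le> (\<Sum>j\<le>K. prob (E j \<inter> V j))"
    by (rule finite_measure_subadditive_finite) auto
  also have "\<dots> \<le> (\<Sum>j\<le>K. prob (E j) * (real j / real k))"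
    by (intro sum_mono EV)
  also have "\<dots> = (\<Sum>j\<le>K. prob (E j) * real j) / real k"
    by (simp add: sum_divide_distrib)
  also have "\<dots> \<le> real K * c / real k"
    unfolding expect by (intro divide_right_mono expect_le) simp
  also have "\<dots> = \<beta>"
    using k by (simp add: c_def K_def)
  finally show "prob {\<omega>\<in>space M. passes k (P \<omega>) (U \<omega>) \<beta>} \<le> \<beta>"
    by (simp add: Z0)
qed

lemma measure_F_UR_le:
  fixes P :: "'a \<Rightarrow> real ^ 'n::finite"
  assumes "prob_space M" and PU: "(P, U) \<in> uniform_vecs_indep M"
    and k: "1 \<le> k" and \<alpha>: "0 < \<alpha>" "\<alpha> < 1"
  shows "measure M {\<omega>\<in>space M. F_UR k (P \<omega>, U \<omega>) \<le> \<alpha>} \<le> \<alpha>"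
\<comment> \<open>Restricting to \<open>\<beta> < 1\<close> keeps the criterion for
  \<open>F_UR k (p, u) < \<beta>\<close> applicable.\<close>
proof (rule dense_ge_bounded[OF \<alpha>(2)])
  interpret prob_space M by fact
  fix \<beta> assume \<beta>: "\<alpha> < \<beta>" "\<beta> < 1"
  have "{\<omega>\<in>space M. F_UR k (P \<omega>, U \<omega>) \<le> \<alpha>} \<subseteq> {\<omega>\<in>space M. passes k (P \<omega>) (U \<omega>) \<beta>}"
  proof safe
    fix \<omega> assume "\<omega> \<in> space M" and "F_UR k (P \<omega>, U \<omega>) \<le> \<alpha>"
    have cube: "P \<omega> \<in> unit_cube"
      using PU \<open>\<omega> \<in> space M\<close>
      by (auto simp: uniform_vecs_indep_def uniform_vecs_def uniform_rvs_def unit_cube_def)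
    have "F_UR k (P \<omega>, U \<omega>) < \<beta>"
      using \<open>F_UR k (P \<omega>, U \<omega>) \<le> \<alpha>\<close> \<beta> by simp
    then obtain \<gamma> where "\<gamma> < \<beta>" "passes k (P \<omega>) (U \<omega>) \<gamma>"
      using F_UR_less_iff[OF cube k, of \<beta> "U \<omega>"] \<beta> by auto
    then show "passes k (P \<omega>) (U \<omega>) \<beta>"
      using passes_mono[OF _ cube order_refl order_refl] by simp
  qed
  then have "prob {\<omega>\<in>space M. F_UR k (P \<omega>, U \<omega>) \<le> \<alpha>}
      \<le> prob {\<omega>\<in>space M. passes k (P \<omega>) (U \<omega>) \<beta>}"
    using measure_passes_le(1)[OF assms(1) PU k] \<alpha> \<beta> by (intro finite_measure_mono) auto
  also have "\<dots> \<le> \<beta>"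
    using measure_passes_le(2)[OF assms(1) PU k] \<alpha> \<beta> by simp
  finally show "prob {\<omega>\<in>space M. F_UR k (P \<omega>, U \<omega>) \<le> \<alpha>} \<le> \<beta>" .
qed

section \<open>Domination of \<open>F_R\<close>\<close>

lemma order_stat_nonneg:
  fixes p :: "real ^ 'n::finite"
  assumes "p \<in> unit_cube" and "1 \<le> j" and "j \<le> CARD('n)"
  shows "0 \<le> order_stat p j"
proof (rule ccontr)
  assume "\<not> 0 \<le> order_stat p j"
  \<comment> \<open>Thresholding at the order statistic itself yields an entry not exceeding
    it.\<close>
  moreover have "1 \<le> card {i. p $ i \<le> order_stat p j}"
    using order_stat_le_iff[OF assms(2,3), of p "order_stat p j"] assms(2) by simp
  then have "{i. p $ i \<le> order_stat p j} \<noteq> {}"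
    by (metis card.empty not_one_le_zero)
  then obtain i where "p $ i \<le> order_stat p j"
    by blast
  ultimately have "p $ i < 0"
    by linarith
  then show False
    using assms(1) by (auto simp: unit_cube_def not_le[symmetric])
qed

text \<open>For \<open>0 < u \<le> 1\<close> the index \<lceil>\<open>u * k\<close>\<rceil> is at
  most \<open>k\<close>, and the minimum and the indicator in the closed form only lower the
  value.\<close>

lemma F_UR_le_F_R:
  fixes p :: "real ^ 'n::finite"
  assumes p: "p \<in> unit_cube" and u: "0 \<le> u" "u \<le> 1" and k: "1 \<le> k" "k \<le> CARD('n)"
  shows "F_UR k (p, u) \<le> F_R k p"
proof (cases "u = 0")
  case True
  then show ?thesis
    using F_UR_u_zero[OF p k(1)] order_stat_nonneg[OF p k] by (simp add: F_R_def)
next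
  case False
  define j where "j = nat \<lceil>u * real k\<rceil>"
  have "0 < u * real k"
    using u False k by simp
  then have j1: "1 \<le> j"
    unfolding j_def by linarith
  have "u * real k \<le> real k"
    using u by (simp add: mult_left_le_one_le)
  then have jk: "j \<le> k"
    by (simp add: j_def ceiling_le_iff)
  have "F_UR k (p, u) \<le> real CARD('n) / real k * order_stat p j * indicator {0<..} (order_stat p 1)"
    using F_UR_closed_form[OF p k, of u] u False by (simp add: j_def)
  also have "\<dots> \<le> real CARD('n) / real k * order_stat p j"
    using order_stat_nonneg[OF p j1] jk k by (simp add: indicator_def)
  also have "\<dots> \<le> F_R k p"
    unfolding F_R_def using order_stat_mono[OF j1 jk k(2)] by (intro mult_left_mono) auto
  finally show ?thesis .
qed

theorem theorem4p2:
  fixes M :: "'a measure" and k :: nat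
  assumes "prob_space M" and "atomless M"
    and "CARD('n::finite) \<ge> 2"
    and "1 \<le> k" and "k \<le> CARD('n)"
  shows "(\<forall>p \<in> (unit_cube :: (real ^ 'n) set). \<forall>u\<in>{0<..1}.
            F_UR k (p, u) =
              min 1 (real CARD('n) / real k * order_stat p (nat \<lceil>u * real k\<rceil>)
                     * indicator {0<..} (order_stat p 1))) \<and>
         randomized_p_merging M (F_UR k :: (real ^ 'n) \<times> real \<Rightarrow> real) \<and>
         strictly_dominates (F_UR k :: (real ^ 'n) \<times> real \<Rightarrow> real) (\<lambda>(p, u). F_R k p)"
proof (intro conjI)
  note k = assms(4,5)
  show "\<forall>p \<in> (unit_cube :: (real ^ 'n) set). \<forall>u\<in>{0<..1}. F_UR k (p, u) =
      min 1 (real CARD('n) / real k * order_stat p (nat \<lceil>u * real k\<rceil>)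
        * indicator {0<..} (order_stat p 1))"
    by (intro ballI F_UR_closed_form k) auto
  show "randomized_p_merging M (F_UR k :: (real ^ 'n) \<times> real \<Rightarrow> real)"
    unfolding randomized_p_merging_def
  proof (intro conjI)
    show "\<forall>x\<in>unit_dom. (F_UR k :: (real ^ 'n) \<times> real \<Rightarrow> real) x \<in> {0..1}"
      unfolding unit_dom_def using F_UR_range[OF _ k(1)] by blast
    show "\<forall>\<alpha>\<in>{0<..<1}. \<forall>(P :: 'a \<Rightarrow> real ^ 'n, U)\<in>uniform_vecs_indep M.
        measure M {\<omega>\<in>space M. F_UR k (P \<omega>, U \<omega>) \<le> \<alpha>} \<le> \<alpha>"
      using measure_F_UR_le[OF assms(1) _ k(1)] by auto
  qed (intro mono_on_F_UR borel_measurable_F_UR k(1))+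
  show "strictly_dominates (F_UR k :: (real ^ 'n) \<times> real \<Rightarrow> real) (\<lambda>(p, u). F_R k p)"
    unfolding strictly_dominates_def
  proof (intro conjI)
    show "\<forall>x\<in>unit_dom. (F_UR k :: (real ^ 'n) \<times> real \<Rightarrow> real) x \<le> (case x of (p, u) \<Rightarrow> F_R k p)"
      using F_UR_le_F_R[OF _ _ _ k] by (auto simp: unit_dom_def)
    \<comment> \<open>Strictness is witnessed at \<open>u = 0\<close>, where \<open>F_UR\<close>
      vanishes; any vector with positive entries makes \<open>F_R\<close> positive.\<close>
    let ?p = "(\<chi> i. 1) :: real ^ 'n"
    have p: "?p \<in> unit_cube"
      by (simp add: unit_cube_def)
    have "0 < order_stat ?p 1"
      by (simp only: order_stat_1_pos_iff) simp
    then have "0 < F_R k ?p"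
      using order_stat_mono[OF order_refl k, of ?p] k by (simp add: F_R_def)
    then have "F_UR k (?p, 0) < (case (?p, 0 :: real) of (p, u) \<Rightarrow> F_R k p)"
      using F_UR_u_zero[OF p k(1)] by simp
    moreover have "(?p, 0 :: real) \<in> unit_dom"
      using p by (simp add: unit_dom_def)
    ultimately show "\<exists>x\<in>unit_dom. (F_UR k :: (real ^ 'n) \<times> real \<Rightarrow> real) x < (case x of (p, u) \<Rightarrow> F_R k p)"
      by blast
  qed
qed

end
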